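(* For any $t>0$, $$ \overline{\mu}_t(c)=\frac{e^{-\frac{L't}{8}}\sqrt{L''}}{\pi\sqrt{2L'}}\cdot\sqrt{\frac{c}{\ln c}}\cdot\exp\left[-\frac{(\ln c)^2}{2L't}\right]\cdot(1+o(1)),\quad c\to+\infty, $$ where, for $c>0$, $$ \overline{\mu}_t(c)=\frac{\sqrt{2L''}\cdot e^{\frac{\pi^2}{2L't}-\frac{L't}{8}}}{\pi L'\sqrt{\pi t}}\cdot\frac{1}{\sqrt{c}}\cdot\int_0^{+\infty}\frac{e^{-\frac{v^2}{2L't}}\,\sinh v\,\sin\frac{\pi v}{L't}}{\sqrt{1+\frac{2\cosh v}{c}+\frac{1}{c^2}}}\,dv . $$
   Context: Let $\varphi\colon\mathbb{R}\to[0,+\infty)$ be infinitely differentiable with compact support, even ($\varphi(q)=\varphi(-q)$ for all $q$), and such that $\int_{\mathbb{R}}\varphi^2(q)\,dq=1$. Constants (primes in $L',L''$ are part of the names): $L'=\int_{\mathbb{R}}(\varphi'(q))^2\,dq>0$ and $L''=\int_{\mathbb{R}}(\varphi''(q))^2\,dq>0$. *)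

theory Defs
  imports "HOL-Analysis.Analysis" "HOL-Library.Landau_Symbols"
begin

definition smooth :: "(real \<Rightarrow> real) \<Rightarrow> bool" where
  "smooth \<phi> \<longleftrightarrow> (\<forall>n x. (deriv ^^ n) \<phi> differentiable (at x))"

definition compact_support :: "(real \<Rightarrow> real) \<Rightarrow> bool" where
  "compact_support \<phi> \<longleftrightarrow> compact (closure {q. \<phi> q \<noteq> 0})"

definition L' :: "(real \<Rightarrow> real) \<Rightarrow> real" where
  "L' \<phi> = (LBINT q. (deriv \<phi> q)\<^sup>2)"

definition L'' :: "(real \<Rightarrow> real) \<Rightarrow> real" where
  "L'' \<phi> = (LBINT q. (deriv (deriv \<phi>) q)\<^sup>2)"

(* Only meaningful for t > 0 and c > 0. *)
definition mu_bar :: "(real \<Rightarrow> real) \<Rightarrow> real \<Rightarrow> real \<Rightarrow> real" where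
  "mu_bar \<phi> t c =
     sqrt (2 * L'' \<phi>) * exp (pi\<^sup>2 / (2 * L' \<phi> * t) - L' \<phi> * t / 8) / (pi * L' \<phi> * sqrt (pi * t))
     * (1 / sqrt c)
     * (LBINT v:{0..}. exp (- v\<^sup>2 / (2 * L' \<phi> * t)) * sinh v * sin (pi * v / (L' \<phi> * t))
          / sqrt (1 + 2 * cosh v / c + 1 / c\<^sup>2))"

end

theory Submission
  imports Defs "HOL-Complex_Analysis.Cauchy_Integral_Theorem" "HOL-Real_Asymp.Real_Asymp"
begin

text \<open>
  Put \<open>a = L' t\<close>. Since \<open>sinh v / \<surd>(1 + 2 cosh v / c + 1 / c\<^sup>2)\<close> is \<open>c\<close> times the derivative of the
  root, an integration by parts turns the integrand into the imaginary part of the root times the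
  derivative of \<open>exp (- (v - i\<pi>)\<^sup>2 / (2 a))\<close>, which has no singularity worse than a square-root
  zero in the strip \<open>0 \<le> Im v \<le> \<pi>\<close>, so that Cauchy's theorem applies up to the boundary.
  The segment from \<open>0\<close> to \<open>i\<pi>\<close> contributes nothing to the imaginary part, and on the line
  \<open>Im v = \<pi>\<close> only the part beyond the branch point \<open>ln c + i\<pi>\<close> does. What remains is a positive
  integral with a Gaussian weight over \<open>u \<ge> ln c\<close>; the substitution \<open>u = ln c + r / ln c\<close> and
  dominated convergence reduce it to \<open>\<Gamma>(3/2)\<close>.
\<close>

section \<open>Exponential and Gamma integrals over the half-line\<close>

lemma has_bochner_integral_lborel_nonneg:
  fixes f :: "real \<Rightarrow> real"
  assumes "\<And>x. x \<in> A \<Longrightarrow> 0 \<le> f x" "(f has_integral I) A"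
    and [measurable]: "f \<in> borel_measurable borel" "A \<in> sets borel"
  shows "has_bochner_integral lborel (\<lambda>x. indicator A x * f x) I"
proof (rule has_bochner_integral_nn_integral)
  show "AE x in lborel. 0 \<le> indicator A x * f x"
    using assms(1) by (auto simp: indicator_def)
  show "0 \<le> I"
    using has_integral_nonneg[OF assms(2,1)] .
qed (use nn_integral_has_integral_lebesgue[OF assms(1,2)] in auto)

lemma integrable_exp_minus_Ici: "integrable lborel (\<lambda>x. indicator {0..} x * exp (- x :: real))"
  using has_bochner_integral_lborel_nonneg[OF _ has_integral_exp_minus_to_infinity[of 1 0]]
  by (auto simp: has_bochner_integral_iff)

text \<open>Euler's integral under the substitution \<open>t = r / k\<close>. With
  \<open>s = 3/2\<close> it serves the final limit twice: \<open>k = 2 * a\<close> makes the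
  dominating function integrable, \<open>k = a\<close> evaluates the limit.\<close>

lemma has_bochner_integral_Gamma:
  fixes s k :: real
  assumes s: "s > 0" and k: "k > 0"
  shows "has_bochner_integral lborel
    (\<lambda>r. indicator {0..} r * (r powr (s - 1) * exp (- (r / k)))) (Gamma s * k powr s)"
proof -
  have "has_bochner_integral lborel (\<lambda>t. indicator {0..} t * (t powr (s - 1) / exp t)) (Gamma s)"
    by (rule has_bochner_integral_lborel_nonneg[OF _ Gamma_integral_real[OF s]]) auto
  then have "has_bochner_integral lborel
      (\<lambda>r. indicator {0..} (0 + 1 / k * r) * ((0 + 1 / k * r) powr (s - 1) / exp (0 + 1 / k * r))) (k * Gamma s)"
    using k by (subst (asm) lborel_has_bochner_integral_real_affine_iff[of "1/k" _ _ 0]) auto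
  then have "has_bochner_integral lborel
      (\<lambda>r. k powr (s - 1) *
        (indicator {0..} (0 + 1 / k * r) * ((0 + 1 / k * r) powr (s - 1) / exp (0 + 1 / k * r))))
      (k powr (s - 1) * (k * Gamma s))"
    by (intro has_bochner_integral_mult_right)
  also have "k powr (s - 1) * (k * Gamma s) = Gamma s * k powr s"
    using k by (simp add: powr_diff)
  also have "(\<lambda>r. k powr (s - 1) *
        (indicator {0..} (0 + 1 / k * r) * ((0 + 1 / k * r) powr (s - 1) / exp (0 + 1 / k * r))))
      = (\<lambda>r. indicator {0..} r * (r powr (s - 1) * exp (- (r / k))))"
    using k by (auto simp: fun_eq_iff indicator_def powr_divide exp_minus field_simps zero_le_divide_iff)
  finally show ?thesis .
qed

section \<open>The square root on the closed strip\<close>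

text \<open>The values of \<open>csqrt\<close> on the negative real axis are its limits from above,
  so the jump is invisible from this side: real and imaginary part are both nonnegative roots, with
  no sign to choose.\<close>

lemma continuous_on_csqrt_upper: "continuous_on {z. 0 \<le> Im z} csqrt"
proof -
  have "csqrt z = complex_of_real (sqrt ((cmod z + Re z) / 2))
      + \<i> * complex_of_real (sqrt ((cmod z - Re z) / 2))" if "Im z \<ge> 0" for z
    using that by (auto simp: complex_eq_iff)
  then show ?thesis
    by (subst continuous_on_cong[OF refl]) (auto intro!: continuous_intros)
qed

text \<open>On the closed strip \<open>0 \<le> Im z \<le> \<pi>\<close> the first factor is taken in the closed upper and the
  second one in the closed lower half plane, so this branch of the root of
  \<open>1 + 2 cosh z / c + 1 / c\<^sup>2\<close> is continuous up to the boundary, branch point included.\<close>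

definition strip_root :: "real \<Rightarrow> complex \<Rightarrow> complex" where
  "strip_root c z =
     csqrt (1 + exp z / of_real c) * cnj (csqrt (cnj (1 + exp (- z) / of_real c)))"

lemma continuous_on_strip_root:
  assumes "c > 0"
  shows "continuous_on {z. 0 \<le> Im z \<and> Im z \<le> pi} (strip_root c)"
  unfolding strip_root_def using assms
  by (intro continuous_intros continuous_on_compose2[OF continuous_on_csqrt_upper])
     (auto simp: Im_exp sin_ge_zero)

lemma holomorphic_on_strip_root:
  assumes c: "c > 0"
  shows "strip_root c holomorphic_on {z. 0 < Im z \<and> Im z < pi}"
proof -
  have pos: "Im (1 + exp z / of_real c) > 0" "Im (1 + exp (- z) / of_real c) < 0"
    if "0 < Im z \<and> Im z < pi" for z
    using that c by (auto simp: Im_exp sin_gt_zero)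
  have nin: "1 + exp z / of_real c \<notin> \<real>\<^sub>\<le>\<^sub>0" "1 + exp (- z) / of_real c \<notin> \<real>\<^sub>\<le>\<^sub>0"
    if "0 < Im z \<and> Im z < pi" for z
    using pos[OF that] by (auto simp: complex_nonpos_Reals_iff)
  \<comment> \<open>In the open strip neither radicand meets the cut, so the two conjugations in
    \<open>strip_root\<close> cancel and the product is visibly holomorphic.\<close>
  have "(\<lambda>z. csqrt (1 + exp z / of_real c) * csqrt (1 + exp (- z) / of_real c))
      holomorphic_on {z. 0 < Im z \<and> Im z < pi}"
    using nin c by (intro holomorphic_intros) auto
  then show ?thesis
  proof (rule holomorphic_transform)
    fix z assume "z \<in> {z. 0 < Im z \<and> Im z < pi}"
    then have "0 < Im z \<and> Im z < pi" by simp
    from cnj_csqrt[OF nin(2)[OF this]]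
    show "csqrt (1 + exp z / of_real c) * csqrt (1 + exp (- z) / of_real c) = strip_root c z"
      unfolding strip_root_def by (metis complex_cnj_cnj)
  qed
qed

lemma root_factorization:
  fixes c x :: real
  assumes "c > 0"
  shows "1 + 2 * cosh x / c + 1 / c\<^sup>2 = (1 + exp x / c) * (1 + exp (- x) / c)"
  using assms by (simp add: cosh_def field_simps power2_eq_square flip: exp_add)

lemma strip_root_of_real:
  assumes c: "c > 0"
  shows "strip_root c (of_real x) = of_real (sqrt (1 + 2 * cosh x / c + 1 / c\<^sup>2))"
proof -
  have "1 + exp (of_real x) / of_real c = complex_of_real (1 + exp x / c)"
    "1 + exp (- of_real x) / of_real c = complex_of_real (1 + exp (- x) / c)"
    by (simp_all flip: exp_of_real)
  moreover have "1 + exp x / c \<ge> 0" "1 + exp (-x) / c \<ge> 0"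
    using c by (simp_all add: add_nonneg_nonneg)
  ultimately show ?thesis
    unfolding strip_root_def root_factorization[OF c] by (simp add: real_sqrt_mult del: of_real_add of_real_divide)
qed

text \<open>Here \<open>exp (- z)\<close> is the conjugate of \<open>exp z\<close>, so the root has
  the form \<open>w * cnj w\<close>.\<close>

lemma Im_strip_root_imaginary_axis: "Im (strip_root c (\<i> * of_real y)) = 0"
proof -
  have "cnj (1 + exp (- (\<i> * of_real y)) / of_real c) = 1 + exp (\<i> * of_real y) / of_real c"
    by (simp add: exp_cnj)
  then show ?thesis
    unfolding strip_root_def by (simp only: complex_mult_cnj Im_complex_of_real)
qed

text \<open>Both radicands are real on this line. The second stays nonnegative, while the first
  changes sign at \<open>x = ln c\<close>; beyond that point its root is purely imaginary. The
  \<open>max 0\<close> covers both sides of the branch point in one formula.\<close>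

lemma Im_strip_root_top:
  assumes c: "c \<ge> 1" and x: "x \<ge> 0"
  shows "Im (strip_root c (of_real x + \<i> * of_real pi)) =
    sqrt (max 0 ((exp x / c - 1) * (1 - exp (- x) / c)))"
proof -
  have "exp (complex_of_real x + \<i> * of_real pi) = of_real (- exp x)"
    "exp (- (complex_of_real x + \<i> * of_real pi)) = of_real (- exp (-x))"
    by (auto simp: complex_eq_iff Re_exp Im_exp)
  then have eq: "1 + exp (complex_of_real x + \<i> * of_real pi) / of_real c = of_real (1 - exp x / c)"
    "1 + exp (- (complex_of_real x + \<i> * of_real pi)) / of_real c = of_real (1 - exp (-x) / c)"
    by simp_all
  have "exp (-x) \<le> 1" using x by simp
  then have "exp (-x) \<le> c" using c by linarith
  then have 2: "1 - exp (-x) / c \<ge> 0"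
    using c by (simp add: field_simps)
  show ?thesis
  proof (cases "1 - exp x / c \<ge> 0")
    case True
    then have "(exp x / c - 1) * (1 - exp (- x) / c) \<le> 0"
      using 2 by (intro mult_nonpos_nonneg) auto
    then show ?thesis
      unfolding strip_root_def eq using True 2 by (simp del: of_real_diff of_real_divide csqrt.sel)
  next
    case False
    then have "(exp x / c - 1) * (1 - exp (- x) / c) \<ge> 0"
      using 2 by (intro mult_nonneg_nonneg) auto
    then show ?thesis
      unfolding strip_root_def eq using False 2
      by (simp add: real_sqrt_mult del: of_real_diff of_real_divide csqrt.sel)
  qed
qed

lemma norm_strip_root_le:
  assumes c: "c \<ge> 1" and z: "Re z \<ge> 0"
  shows "cmod (strip_root c z) \<le> 2 * exp (Re z)"
proof -
  have "cmod (1 + exp z / of_real c) \<le> 1 + exp (Re z) / c"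
    using norm_triangle_ineq[of 1 "exp z / of_real c"] c by (simp add: norm_divide)
  also have "\<dots> \<le> 1 + exp (Re z)" using c by (simp add: divide_le_eq)
  also have "\<dots> \<le> 2 * exp (Re z)" using z by simp
  finally have 1: "cmod (1 + exp z / of_real c) \<le> 2 * exp (Re z)" .
  have "cmod (1 + exp (-z) / of_real c) \<le> 1 + exp (- Re z) / c"
    using norm_triangle_ineq[of 1 "exp (-z) / of_real c"] c by (simp add: norm_divide)
  also have "\<dots> \<le> 1 + exp (- Re z)" using c by (simp add: divide_le_eq)
  also have "\<dots> \<le> 2 * exp (Re z)" using z
    by (smt (verit, best) exp_le_one_iff one_le_exp_iff)
  finally have 2: "cmod (1 + exp (-z) / of_real c) \<le> 2 * exp (Re z)" .
  have "cmod (strip_root c z) = sqrt (cmod (1 + exp z / of_real c)) * sqrt (cmod (1 + exp (-z) / of_real c))"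
    unfolding strip_root_def by (simp only: norm_mult complex_mod_cnj norm_csqrt)
  also have "\<dots> \<le> sqrt (2 * exp (Re z)) * sqrt (2 * exp (Re z))"
    using 1 2 by (intro mult_mono real_sqrt_le_mono) auto
  finally show ?thesis by simp
qed

section \<open>The contour integrand and its values on the sides of the strip\<close>

text \<open>Lets a complex primitive be used through real calculus in place of path integrals:
  \<open>d = 1\<close> on the two horizontal sides of the rectangle, \<open>d = \<i>\<close> on the
  left one.\<close>

lemma Im_primitive_along_line:
  assumes "\<And>z. z \<in> S \<Longrightarrow> (G has_field_derivative F z) (at z within S)"
    and "\<And>t. t \<in> T \<Longrightarrow> p + of_real t * d \<in> S" and "t \<in> T"
  shows "((\<lambda>t. Im (G (p + of_real t * d))) has_real_derivative
    Im (d * F (p + of_real t * d))) (at t within T)"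
proof -
  have "((\<lambda>t. p + of_real t * d) has_vector_derivative d) (at t within T)"
    by (auto intro!: derivative_eq_intros)
  then have "(G \<circ> (\<lambda>t. p + of_real t * d) has_vector_derivative d * F (p + of_real t * d)) (at t within T)"
    by (rule field_vector_diff_chain_within) (use assms in \<open>auto intro!: DERIV_subset[OF assms(1)]\<close>)
  from bounded_linear.has_vector_derivative[OF bounded_linear_Im this]
  show ?thesis
    by (simp add: o_def has_real_derivative_iff_has_vector_derivative)
qed

text \<open>The factor after the root is the derivative of
  \<open>exp (- (z - \<i> * pi)\<^sup>2 / (2 * a))\<close>. Centring this Gaussian at
  \<open>\<i> * pi\<close> makes it real on the top line and produces the phase
  \<open>pi * x / a\<close> on the real axis.\<close>

definition strip_integrand :: "real \<Rightarrow> real \<Rightarrow> complex \<Rightarrow> complex" where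
  "strip_integrand a c z = strip_root c z *
     (- (z - \<i> * pi) / a * exp (- (z - \<i> * pi)\<^sup>2 / (2 * a)))"

text \<open>On a convex set, continuity up to the boundary and holomorphy in the interior suffice
  for a primitive. Its derivative within the closed strip is the integrand even at the branch points
  on the line \<open>Im z = pi\<close>.\<close>

lemma strip_integrand_primitive:
  assumes a: "a > 0" and c: "c > 0"
  obtains G where "\<And>z. z \<in> {z. 0 \<le> Im z \<and> Im z \<le> pi} \<Longrightarrow>
    (G has_field_derivative strip_integrand a c z) (at z within {z. 0 \<le> Im z \<and> Im z \<le> pi})"
proof (rule holomorphic_convex_primitive)
  let ?S = "{z. 0 \<le> Im z \<and> Im z \<le> pi}"
  have S: "?S = {z. \<i> \<bullet> z \<ge> 0} \<inter> {z. \<i> \<bullet> z \<le> pi}"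
    by (auto simp: inner_complex_def)
  show "convex ?S"
    unfolding S by (intro convex_Int convex_halfspace_ge convex_halfspace_le)
  have int: "interior ?S \<subseteq> {z. 0 < Im z \<and> Im z < pi}"
  proof -
    have "interior {z. \<i> \<bullet> z \<ge> 0} = {z. \<i> \<bullet> z > 0}" "interior {z. \<i> \<bullet> z \<le> pi} = {z. \<i> \<bullet> z < pi}"
      by (simp_all only: interior_halfspace_ge interior_halfspace_le complex_i_not_zero not_False_eq_True)
    then show ?thesis
      unfolding S interior_Int by (auto simp: inner_complex_def)
  qed
  show "finite ({}::complex set)" by simp
  show "continuous_on ?S (strip_integrand a c)"
    unfolding strip_integrand_def using a c
    by (intro continuous_intros continuous_on_strip_root) auto
  have hol: "strip_integrand a c holomorphic_on {z. 0 < Im z \<and> Im z < pi}"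
    unfolding strip_integrand_def using a c
    by (intro holomorphic_intros holomorphic_on_strip_root) auto
  have "open {z. 0 < Im z \<and> Im z < pi}"
    by (intro open_Collect_conj open_Collect_less continuous_intros)
  then show "strip_integrand a c field_differentiable at z" if "z \<in> interior ?S - {}" for z
    using holomorphic_on_imp_differentiable_at[OF hol] that int by blast
qed (use that in blast)

text \<open>The innermost product is the derivative of
  \<open>exp (- x\<^sup>2 / (2 * a)) * sin (pi * x / a)\<close>, the form needed for the integration
  by parts.\<close>

lemma Im_strip_integrand_real_axis:
  assumes a: "a > 0" and c: "c > 0"
  shows "Im (strip_integrand a c (of_real x)) = exp (pi\<^sup>2 / (2 * a)) *
    (sqrt (1 + 2 * cosh x / c + 1 / c\<^sup>2) *
     (exp (- x\<^sup>2 / (2 * a)) * (pi / a * cos (pi * x / a) - x / a * sin (pi * x / a))))"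
proof -
  have "- (of_real x - \<i> * pi)\<^sup>2 / (2 * a) =
      of_real ((pi\<^sup>2 - x\<^sup>2) / (2 * a)) + \<i> * of_real (pi * x / a)"
    using a by (simp add: complex_eq_iff power2_eq_square field_simps)
  then have "exp (- (of_real x - \<i> * pi)\<^sup>2 / (2 * a)) =
      of_real (exp ((pi\<^sup>2 - x\<^sup>2) / (2 * a))) * cis (pi * x / a)"
    by (simp only: exp_add exp_of_real cis_conv_exp)
  moreover have "exp ((pi\<^sup>2 - x\<^sup>2) / (2 * a)) = exp (pi\<^sup>2 / (2 * a)) * exp (- x\<^sup>2 / (2 * a))"
    by (simp add: diff_divide_distrib flip: exp_add)
  ultimately have gauss: "exp (- (of_real x - \<i> * pi)\<^sup>2 / (2 * a)) =
      of_real (exp (pi\<^sup>2 / (2 * a)) * exp (- x\<^sup>2 / (2 * a))) * cis (pi * x / a)"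
    by (simp only:)
  have factor: "- (complex_of_real x - \<i> * pi) / a = Complex (- x / a) (pi / a)"
    by (simp add: complex_eq_iff)
  have "Im (of_real s * (Complex (- x / a) (pi / a) * (of_real (k * e) * cis \<theta>))) =
      k * (s * (e * (pi / a * cos \<theta> - x / a * sin \<theta>)))" for s k e \<theta> :: real
    by (simp add: algebra_simps)
  then show ?thesis
    unfolding strip_integrand_def strip_root_of_real[OF c] gauss factor .
qed

text \<open>The leading \<open>\<i>\<close> is the direction of the path. It makes the linear factor
  real; the Gaussian and the root are real on this axis already.\<close>

lemma Im_strip_integrand_imaginary_axis:
  "Im (\<i> * strip_integrand a c (\<i> * of_real y)) = 0"
proof -
  have factor: "\<i> * (- (\<i> * of_real y - \<i> * pi) / a) = of_real ((y - pi) / a)"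
    by (simp add: complex_eq_iff)
  have gauss: "- (\<i> * of_real y - \<i> * pi)\<^sup>2 / (2 * a) = of_real ((y - pi)\<^sup>2 / (2 * a))"
    by (simp add: complex_eq_iff power2_eq_square algebra_simps)
  have "\<i> * (s * (d * e)) = s * (\<i> * d * e)" for s d e :: complex
    by simp
  then have "\<i> * strip_integrand a c (\<i> * of_real y) = strip_root c (\<i> * of_real y) *
      (of_real ((y - pi) / a) * of_real (exp ((y - pi)\<^sup>2 / (2 * a))))"
    unfolding strip_integrand_def by (simp only: factor gauss exp_of_real)
  then show ?thesis
    using Im_strip_root_imaginary_axis[of c y] by (simp flip: of_real_mult)
qed

text \<open>Minus the imaginary part of \<open>strip_integrand\<close> on the line
  \<open>Im z = pi\<close>. For \<open>c \<ge> 1\<close> the \<open>max 0\<close> makes it vanish on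
  \<open>0 \<le> u \<le> ln c\<close>, so integrals from \<open>0\<close> really start at the branch
  point.\<close>

definition cut_density :: "real \<Rightarrow> real \<Rightarrow> real \<Rightarrow> real" where
  "cut_density a c u = u / a * exp (- u\<^sup>2 / (2 * a)) *
     sqrt (max 0 ((exp u / c - 1) * (1 - exp (- u) / c)))"

lemma Im_strip_integrand_top:
  assumes c: "c \<ge> 1" and x: "x \<ge> 0"
  shows "Im (strip_integrand a c (\<i> * pi + of_real x)) = - cut_density a c x"
proof -
  have "- (\<i> * pi + of_real x - \<i> * pi)\<^sup>2 / (2 * a) = complex_of_real (- x\<^sup>2 / (2 * a))"
    by simp
  then have "exp (- (\<i> * pi + of_real x - \<i> * pi)\<^sup>2 / (2 * a)) = complex_of_real (exp (- x\<^sup>2 / (2 * a)))"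
    by (simp only: exp_of_real)
  then have eq: "- (\<i> * pi + of_real x - \<i> * pi) / a * exp (- (\<i> * pi + of_real x - \<i> * pi)\<^sup>2 / (2 * a))
      = complex_of_real (- (x / a * exp (- x\<^sup>2 / (2 * a))))"
    by simp
  have root: "Im (strip_root c (\<i> * pi + of_real x)) =
      sqrt (max 0 ((exp x / c - 1) * (1 - exp (- x) / c)))"
    using Im_strip_root_top[OF c x] by (simp only: add.commute)
  show ?thesis
    unfolding strip_integrand_def eq cut_density_def root[symmetric] by simp
qed

lemma norm_strip_integrand_le:
  assumes a: "a > 0" and c: "c \<ge> 1" and z: "Re z \<ge> 0" "0 \<le> Im z" "Im z \<le> pi"
  shows "cmod (strip_integrand a c z) \<le>
    2 * exp (Re z) * ((Re z + pi) / a * exp ((pi\<^sup>2 - (Re z)\<^sup>2) / (2 * a)))"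
proof -
  have "cmod (z - \<i> * pi) \<le> \<bar>Re (z - \<i> * pi)\<bar> + \<bar>Im (z - \<i> * pi)\<bar>"
    by (rule cmod_le)
  also have "\<dots> \<le> Re z + pi" using z by simp
  finally have 1: "cmod (- (z - \<i> * pi) / a) \<le> (Re z + pi) / a"
    using a by (simp add: norm_divide divide_right_mono norm_minus_commute)
  have "(Im z - pi)\<^sup>2 \<le> pi\<^sup>2"
    using z by (intro power2_le_iff_abs_le[THEN iffD2]) auto
  moreover have "Re (- (z - \<i> * pi)\<^sup>2 / (2 * a)) = ((Im z - pi)\<^sup>2 - (Re z)\<^sup>2) / (2 * a)"
    using a by (simp add: power2_eq_square field_simps)
  ultimately have "Re (- (z - \<i> * pi)\<^sup>2 / (2 * a)) \<le> (pi\<^sup>2 - (Re z)\<^sup>2) / (2 * a)"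
    using a by (simp add: divide_right_mono)
  then have 2: "cmod (exp (- (z - \<i> * pi)\<^sup>2 / (2 * a))) \<le> exp ((pi\<^sup>2 - (Re z)\<^sup>2) / (2 * a))"
    by simp
  show ?thesis
    unfolding strip_integrand_def norm_mult
    by (intro mult_mono norm_strip_root_le 1 2 c z) (use a z in auto)
qed

section \<open>Shifting the contour to the top of the strip\<close>

text \<open>Cauchy's theorem on the rectangle with corners \<open>0\<close>, \<open>R\<close>,
  \<open>R + \<i> * pi\<close>, \<open>\<i> * pi\<close>. In the error, the summand \<open>1\<close>
  comes from the boundary term of the integration by parts at \<open>R\<close>, the other summand
  from the right side.\<close>

lemma finite_contour_shift:
  fixes a c R :: real
  assumes a: "a > 0" and c: "c \<ge> 1" and R: "R \<ge> 0"
  shows "\<bar>(LBINT v:{0..R}. exp (- v\<^sup>2 / (2 * a)) * sinh v * sin (pi * v / a)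
        / sqrt (1 + 2 * cosh v / c + 1 / c\<^sup>2))
      - c * exp (- pi\<^sup>2 / (2 * a)) * (LBINT u:{0..R}. cut_density a c u)\<bar>
    \<le> c * (2 * exp R * exp (- R\<^sup>2 / (2 * a)) * (1 + pi * (R + pi) / a))"
proof -
  let ?S = "{z. 0 \<le> Im z \<and> Im z \<le> pi}"
  let ?s = "\<lambda>x. sqrt (1 + 2 * cosh x / c + 1 / c\<^sup>2)"
  let ?E = "\<lambda>x. exp (- x\<^sup>2 / (2 * a)) * sin (pi * x / a)"
  let ?k = "exp (- pi\<^sup>2 / (2 * a))"
  from c have c0: "c > 0" by simp
  have spos: "1 + 2 * cosh x / c + 1 / c\<^sup>2 > 0" for x :: real
    using c0 by (intro add_pos_nonneg) (auto intro: less_imp_le)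
  obtain G where G: "\<And>z. z \<in> ?S \<Longrightarrow> (G has_field_derivative strip_integrand a c z) (at z within ?S)"
    using strip_integrand_primitive[OF a c0] by metis
  \<comment> \<open>The derivative of \<open>?s\<close> is \<open>sinh x / (c * ?s x)\<close>. Hence
    differentiating \<open>c * (?s x * ?E x)\<close> gives the integrand plus
    \<open>c * ?s x\<close> times the derivative of \<open>?E\<close>, and the term with
    \<open>G\<close> removes that surplus.\<close>
  let ?D = "\<lambda>x. c * (?s x * ?E x) - c * ?k * Im (G (of_real x))"

  have "(LBINT v:{0..R}. exp (- v\<^sup>2 / (2 * a)) * sinh v * sin (pi * v / a) / ?s v) = ?D R - ?D 0"
    unfolding set_lebesgue_integral_def
  proof (rule integral_FTC_Icc[OF R])
    fix x assume x: "0 \<le> x" "x \<le> R"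
    have "((\<lambda>x. Im (G (of_real x))) has_real_derivative Im (strip_integrand a c (of_real x)))
        (at x within {0..R})"
      using Im_primitive_along_line[where p = 0 and d = 1, OF G, of "{0..R}" x] x by simp
    moreover have "(?E has_real_derivative
        exp (- x\<^sup>2 / (2 * a)) * (pi / a * cos (pi * x / a) - x / a * sin (pi * x / a))) (at x within {0..R})"
      using a by (auto intro!: derivative_eq_intros simp: field_simps)
    moreover have "(?s has_real_derivative sinh x / (c * ?s x)) (at x within {0..R})"
      using c0 spos[of x] by (auto intro!: derivative_eq_intros simp: field_simps)
    ultimately have "(?D has_real_derivative
        c * (?s x * (exp (- x\<^sup>2 / (2 * a)) * (pi / a * cos (pi * x / a) - x / a * sin (pi * x / a)))
           + sinh x / (c * ?s x) * ?E x)
        - c * ?k * Im (strip_integrand a c (of_real x))) (at x within {0..R})"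
      by (intro DERIV_diff DERIV_cmult DERIV_mult')
    also have "c * (?s x * (exp (- x\<^sup>2 / (2 * a)) * (pi / a * cos (pi * x / a) - x / a * sin (pi * x / a)))
           + sinh x / (c * ?s x) * ?E x)
        - c * ?k * Im (strip_integrand a c (of_real x))
      = exp (- x\<^sup>2 / (2 * a)) * sinh x * sin (pi * x / a) / ?s x"
    proof -
      have k: "?k * (exp (pi\<^sup>2 / (2 * a)) * y) = y" for y
        by (simp add: exp_minus)
      show ?thesis
        unfolding Im_strip_integrand_real_axis[OF a c0] mult.assoc k
        using c0 by (simp add: algebra_simps)
    qed
    finally show "(?D has_vector_derivative
        exp (- x\<^sup>2 / (2 * a)) * sinh x * sin (pi * x / a) / ?s x) (at x within {0..R})"
      by (simp add: has_real_derivative_iff_has_vector_derivative)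
  next
    show "continuous_on {0..R} (\<lambda>v. exp (- v\<^sup>2 / (2 * a)) * sinh v * sin (pi * v / a) / ?s v)"
      using a c0 spos by (intro continuous_intros) (auto simp: less_imp_neq[THEN not_sym])
  qed
  \<comment> \<open>The lower endpoint leaves no product term since \<open>?E 0 = 0\<close>.\<close>
  then have bottom: "(LBINT v:{0..R}. exp (- v\<^sup>2 / (2 * a)) * sinh v * sin (pi * v / a) / ?s v) =
      c * (?s R * ?E R) - c * ?k * (Im (G (of_real R)) - Im (G 0))"
    by (simp add: algebra_simps)

  have "(LBINT u:{0..R}. cut_density a c u) =
      - Im (G (\<i> * pi + of_real R)) - - Im (G (\<i> * pi + of_real 0))"
    unfolding set_lebesgue_integral_def
  proof (rule integral_FTC_Icc[OF R])
    fix x assume x: "0 \<le> x" "x \<le> R"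
    have "((\<lambda>x. Im (G (\<i> * pi + of_real x))) has_real_derivative
        Im (strip_integrand a c (\<i> * pi + of_real x))) (at x within {0..R})"
      using Im_primitive_along_line[where p = "\<i> * pi" and d = 1, OF G, of "{0..R}" x] x by simp
    from DERIV_minus[OF this]
    show "((\<lambda>x. - Im (G (\<i> * pi + of_real x))) has_vector_derivative cut_density a c x) (at x within {0..R})"
      using x by (simp add: has_real_derivative_iff_has_vector_derivative Im_strip_integrand_top[OF c])
  next
    show "continuous_on {0..R} (cut_density a c)"
      unfolding cut_density_def using a c0 by (intro continuous_intros) auto
  qed
  then have top: "(LBINT u:{0..R}. cut_density a c u) = Im (G (\<i> * pi)) - Im (G (\<i> * pi + of_real R))"
    by simp

  \<comment> \<open>The left side: \<open>Im G\<close> has derivative zero along it, so its two ends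
    agree.\<close>
  have "\<exists>C. \<forall>y\<in>{0..pi}. Im (G (0 + of_real y * \<i>)) = C"
  proof (rule has_field_derivative_zero_constant)
    fix y assume y: "y \<in> {0..pi}"
    show "((\<lambda>y. Im (G (0 + of_real y * \<i>))) has_real_derivative 0) (at y within {0..pi})"
      using Im_primitive_along_line[where p = 0 and d = \<i>, OF G, of "{0..pi}" y] y
        Im_strip_integrand_imaginary_axis[of a c y] by (simp add: mult.commute)
  qed auto
  then obtain C where C: "\<forall>y\<in>{0..pi}. Im (G (0 + of_real y * \<i>)) = C" ..
  have left: "Im (G (\<i> * pi)) = Im (G 0)"
    using C[rule_format, of 0] C[rule_format, of pi] by (simp add: mult.commute)

  \<comment> \<open>The right side has length \<open>pi\<close>, and \<open>?B\<close> bounds the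
    integrand there. Multiplication by \<open>?k\<close> later cancels the
    \<open>exp (pi\<^sup>2 / (2 * a))\<close> hidden in \<open>?B\<close>.\<close>
  let ?B = "2 * exp R * ((R + pi) / a * exp ((pi\<^sup>2 - R\<^sup>2) / (2 * a)))"
  have "cmod (G (of_real R + \<i> * pi) - G (of_real R)) \<le> ?B * cmod (of_real R + \<i> * pi - of_real R)"
  proof (rule field_differentiable_bound)
    show "convex (?S \<inter> {z. Re z = R})"
      by (auto simp: convex_alt intro: convex_bound_le) (auto simp: algebra_simps)
    show "(G has_field_derivative strip_integrand a c z) (at z within ?S \<inter> {z. Re z = R})"
      if "z \<in> ?S \<inter> {z. Re z = R}" for z
      using that by (intro DERIV_subset[OF G]) auto
    show "cmod (strip_integrand a c z) \<le> ?B" if "z \<in> ?S \<inter> {z. Re z = R}" for z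
      using norm_strip_integrand_le[OF a c, of z] that R by auto
  qed auto
  also have "\<dots> = ?B * pi" by (simp add: norm_mult)
  finally have "\<bar>Im (G (\<i> * pi + of_real R)) - Im (G (of_real R))\<bar> \<le> ?B * pi"
    using abs_Im_le_cmod[of "G (of_real R + \<i> * pi) - G (of_real R)"] by (simp add: add.commute)
  then have right: "?k * \<bar>Im (G (\<i> * pi + of_real R)) - Im (G (of_real R))\<bar> \<le> ?k * (?B * pi)"
    by (intro mult_left_mono) auto
  also have "?k * (?B * pi) = 2 * exp R * exp (- R\<^sup>2 / (2 * a)) * (pi * (R + pi) / a)"
  proof -
    have "exp ((pi\<^sup>2 - R\<^sup>2) / (2 * a)) * ?k = exp (- R\<^sup>2 / (2 * a))"
      by (simp add: diff_divide_distrib flip: exp_add)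
    then show ?thesis by (simp add: mult_ac)
  qed
  finally have right: "?k * \<bar>Im (G (\<i> * pi + of_real R)) - Im (G (of_real R))\<bar>
      \<le> 2 * exp R * exp (- R\<^sup>2 / (2 * a)) * (pi * (R + pi) / a)" .

  have "\<bar>?s R\<bar> \<le> 2 * exp R"
    using norm_strip_root_le[OF c, of "of_real R"] R by (simp add: strip_root_of_real[OF c0])
  moreover have "\<bar>?E R\<bar> \<le> exp (- R\<^sup>2 / (2 * a))"
    by (simp add: abs_mult mult_left_le)
  ultimately have endpoint: "\<bar>?s R * ?E R\<bar> \<le> 2 * exp R * exp (- R\<^sup>2 / (2 * a))"
    unfolding abs_mult[of "?s R"] by (intro mult_mono) auto

  have "(LBINT v:{0..R}. exp (- v\<^sup>2 / (2 * a)) * sinh v * sin (pi * v / a) / ?s v)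
      - c * ?k * (LBINT u:{0..R}. cut_density a c u)
    = c * (?s R * ?E R + ?k * (Im (G (\<i> * pi + of_real R)) - Im (G (of_real R))))"
    unfolding bottom top left by (simp add: algebra_simps)
  also have "\<bar>\<dots>\<bar> = c * \<bar>?s R * ?E R + ?k * (Im (G (\<i> * pi + of_real R)) - Im (G (of_real R)))\<bar>"
    using c0 by (simp add: abs_mult)
  also have "\<dots> \<le> c * (\<bar>?s R * ?E R\<bar> + ?k * \<bar>Im (G (\<i> * pi + of_real R)) - Im (G (of_real R))\<bar>)"
    using c0 abs_triangle_ineq[of "?s R * ?E R" "?k * (Im (G (\<i> * pi + of_real R)) - Im (G (of_real R)))"]
    by (intro mult_left_mono) (auto simp: abs_mult)
  also have "\<dots> \<le> c * (2 * exp R * exp (- R\<^sup>2 / (2 * a))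
      + 2 * exp R * exp (- R\<^sup>2 / (2 * a)) * (pi * (R + pi) / a))"
    using c0 endpoint right by (intro mult_left_mono add_mono) auto
  finally show ?thesis by (simp add: algebra_simps)
qed

text \<open>The square \<open>(v - 3 * a)\<^sup>2 \<ge> 0\<close> bounds the weight by
  \<open>exp (9 * a / 2) * exp (- v)\<close>: of the rate \<open>3\<close>, two units absorb
  \<open>exp (2 * v)\<close> and one is left for decay.\<close>

lemma set_integrable_gaussian_dominated:
  fixes f :: "real \<Rightarrow> real"
  assumes a: "a > 0" and [measurable]: "f \<in> borel_measurable borel"
    and f: "\<And>v. v \<ge> 0 \<Longrightarrow> \<bar>f v\<bar> \<le> K * (exp (- v\<^sup>2 / (2 * a)) * exp (2 * v))"
  shows "set_integrable lborel {0..} f"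
  unfolding set_integrable_def
proof (rule Bochner_Integration.integrable_bound)
  let ?w = "\<lambda>v. K * exp (9 * a / 2) * (indicator {0..} v * exp (- v :: real))"
  show "integrable lborel ?w"
    using integrable_exp_minus_Ici by (intro integrable_mult_right)
  have "norm (indicator {0..} v *\<^sub>R f v) \<le> norm (?w v)" for v
  proof (cases "v \<ge> 0")
    case True
    \<comment> \<open>At \<open>v = 0\<close> the weight is \<open>1\<close>, which forces
      \<open>K \<ge> 0\<close>.\<close>
    have "\<bar>f 0\<bar> \<le> K * (exp (- 0\<^sup>2 / (2 * a)) * exp (2 * 0))"
      by (rule f) simp
    then have K: "K \<ge> 0" by simp
    have "0 \<le> (v - 3 * a)\<^sup>2 / (2 * a)" using a by simp
    also have "\<dots> = v\<^sup>2 / (2 * a) - 3 * v + 9 * a / 2"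
      using a by (simp add: field_simps power2_eq_square)
    finally have "exp (- v\<^sup>2 / (2 * a) + 2 * v) \<le> exp (9 * a / 2 + - v)"
      by (subst exp_le_cancel_iff) simp
    then have "exp (- v\<^sup>2 / (2 * a)) * exp (2 * v) \<le> exp (9 * a / 2) * exp (- v)"
      by (simp only: exp_add)
    then have "K * (exp (- v\<^sup>2 / (2 * a)) * exp (2 * v)) \<le> K * (exp (9 * a / 2) * exp (- v))"
      using K by (rule mult_left_mono)
    with f[OF True] have "\<bar>f v\<bar> \<le> K * (exp (9 * a / 2) * exp (- v))"
      by linarith
    then show ?thesis using True K by (simp add: abs_mult mult_ac)
  qed simp
  then show "AE v in lborel. norm (indicator {0..} v *\<^sub>R f v) \<le> norm (?w v)" by simp
qed simp

lemma contour_shift: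
  fixes a c :: real
  assumes a: "a > 0" and c: "c \<ge> 1"
  shows "(LBINT v:{0..}. exp (- v\<^sup>2 / (2 * a)) * sinh v * sin (pi * v / a)
        / sqrt (1 + 2 * cosh v / c + 1 / c\<^sup>2))
      = c * exp (- pi\<^sup>2 / (2 * a)) * (LBINT u:{0..}. cut_density a c u)"
    (is "?I = ?k * ?J")
proof -
  let ?f = "\<lambda>v. exp (- v\<^sup>2 / (2 * a)) * sinh v * sin (pi * v / a)
        / sqrt (1 + 2 * cosh v / c + 1 / c\<^sup>2)"
  have intf: "set_integrable lborel {0..} ?f"
  proof (rule set_integrable_gaussian_dominated[OF a, where K = 1])
    fix v :: real assume v: "v \<ge> 0"
    have "sinh v \<le> exp (2 * v)"
    proof -
      have "sinh v \<le> exp v" using sinh_plus_cosh[of v] cosh_real_nonneg[of v] by linarith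
      also have "\<dots> \<le> exp (2 * v)" using v by simp
      finally show ?thesis .
    qed
    moreover have "sinh v \<ge> 0" using v by simp
    moreover have "1 \<le> sqrt (1 + 2 * cosh v / c + 1 / c\<^sup>2)"
      using c by simp
    ultimately have "\<bar>exp (- v\<^sup>2 / (2 * a)) * sinh v * sin (pi * v / a)\<bar>
        / sqrt (1 + 2 * cosh v / c + 1 / c\<^sup>2) \<le> exp (- v\<^sup>2 / (2 * a)) * exp (2 * v) * 1 / 1"
      unfolding abs_mult by (intro frac_le mult_mono) simp_all
    then show "\<bar>?f v\<bar> \<le> 1 * (exp (- v\<^sup>2 / (2 * a)) * exp (2 * v))"
      using \<open>1 \<le> sqrt _\<close> by simp
  qed (unfold sinh_def cosh_def, measurable)
  have intg: "set_integrable lborel {0..} (cut_density a c)"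
  proof (rule set_integrable_gaussian_dominated[OF a, where K = "1 / a"])
    fix u :: real assume u: "u \<ge> 0"
    have "(exp u / c - 1) * (1 - exp (- u) / c) \<le> exp (2 * u)"
    proof -
      have "exp (- u) \<le> c" using u c by (smt (verit) exp_le_one_iff)
      then have b: "0 \<le> 1 - exp (- u) / c" "1 - exp (- u) / c \<le> 1"
        using c by (auto simp: field_simps)
      have "(exp u / c - 1) * (1 - exp (- u) / c) \<le> (exp u / c) * (1 - exp (- u) / c)"
        using b by (intro mult_right_mono) auto
      also have "\<dots> \<le> exp u / c"
        using b c by (intro mult_left_le) auto
      also have "\<dots> \<le> exp u" using c by (simp add: divide_le_eq)
      also have "\<dots> \<le> exp (2 * u)" using u by simp
      finally show ?thesis .
    qed
    then have "sqrt (max 0 ((exp u / c - 1) * (1 - exp (- u) / c))) \<le> sqrt (exp (2 * u))"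
      by (intro real_sqrt_le_mono) simp
    also have "\<dots> = exp u" by (simp add: exp_double)
    finally have root: "sqrt (max 0 ((exp u / c - 1) * (1 - exp (- u) / c))) \<le> exp u" .
    \<comment> \<open>One \<open>exp u\<close> bounds the root and a second one the linear factor,
      which accounts for the weight \<open>exp (2 * u)\<close>.\<close>
    have "u \<le> exp u" using exp_ge_add_one_self[of u] by linarith
    with root have "cut_density a c u \<le> exp u / a * exp (- u\<^sup>2 / (2 * a)) * exp u"
      unfolding cut_density_def using a u
      by (intro mult_mono divide_right_mono) auto
    also have "\<dots> = 1 / a * (exp (- u\<^sup>2 / (2 * a)) * exp (2 * u))"
      by (simp add: exp_double power2_eq_square)
    finally show "\<bar>cut_density a c u\<bar> \<le> 1 / a * (exp (- u\<^sup>2 / (2 * a)) * exp (2 * u))"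
      using a u by (simp add: cut_density_def)
  qed (unfold cut_density_def, measurable)
  \<comment> \<open>The truncated difference tends both to the full difference and, by the Gaussian
    factor in the error bound, to zero.\<close>
  have "((\<lambda>R. (LBINT v:{0..R}. ?f v) - ?k * (LBINT u:{0..R}. cut_density a c u)) \<longlongrightarrow> ?I - ?k * ?J) at_top"
    by (intro tendsto_intros tendsto_set_lebesgue_integral_at_top intf intg) auto
  moreover have "((\<lambda>R. (LBINT v:{0..R}. ?f v) - ?k * (LBINT u:{0..R}. cut_density a c u)) \<longlongrightarrow> 0) at_top"
  proof (rule Lim_null_comparison)
    show "\<forall>\<^sub>F R in at_top. norm ((LBINT v:{0..R}. ?f v) - ?k * (LBINT u:{0..R}. cut_density a c u))
        \<le> c * (2 * exp R * exp (- R\<^sup>2 / (2 * a)) * (1 + pi * (R + pi) / a))"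
      by (rule eventually_mono[OF eventually_ge_at_top[of 0]])
        (use finite_contour_shift[OF a c] in simp)
    show "((\<lambda>R. c * (2 * exp R * exp (- R\<^sup>2 / (2 * a)) * (1 + pi * (R + pi) / a))) \<longlongrightarrow> 0) at_top"
      using a by real_asymp
  qed
  ultimately have "?I - ?k * ?J = 0"
    using tendsto_unique trivial_limit_at_top_linorder by blast
  then show ?thesis by simp
qed

section \<open>Laplace asymptotics at the branch point\<close>

text \<open>What \<open>cut_density\<close> becomes under \<open>u = ln c + r / ln c\<close> once
  its leading size is split off. The \<open>ln c\<close> inside the root compensates
  \<open>exp (r / ln c) - 1\<close>, so that the root tends to \<open>sqrt r\<close>.\<close>

definition laplace_integrand :: "real \<Rightarrow> real \<Rightarrow> real \<Rightarrow> real" where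
  "laplace_integrand a c r = indicator {0..} r *
     ((1 + r / (ln c)\<^sup>2) * exp (- (r / a) - r\<^sup>2 / (2 * a * (ln c)\<^sup>2)) *
      sqrt (ln c * (exp (r / ln c) - 1) * (1 - exp (- (r / ln c)) / c\<^sup>2)))"

text \<open>With \<open>l = ln c\<close>, the square of \<open>l + r / l\<close> is
  \<open>l\<^sup>2 + 2 * r + r\<^sup>2 / l\<^sup>2\<close>; the step \<open>1 / l\<close> is chosen
  so that the cross term is free of \<open>c\<close>. The Jacobian cancels the \<open>l\<close> in
  the factor \<open>u\<close>, and the root leaves \<open>1 / sqrt l\<close>.\<close>

lemma integral_cut_density_rescale:
  assumes a: "a > 0" and c: "c > 1"
  shows "(LBINT u:{0..}. cut_density a c u) =
    exp (- (ln c)\<^sup>2 / (2 * a)) / (a * sqrt (ln c)) * (LBINT r. laplace_integrand a c r)"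
proof -
  define l where "l = ln c"
  have l: "l > 0" and cl: "c = exp l" using c by (auto simp: l_def)
  have pointwise: "indicator {0..} (l + 1 / l * r) * cut_density a c (l + 1 / l * r) =
      l * exp (- l\<^sup>2 / (2 * a)) / (a * sqrt l) * laplace_integrand a c r" for r
  proof -
    let ?u = "l + 1 / l * r"
    have eu: "exp ?u / c = exp (r / l)" "exp (- ?u) / c = exp (- (r / l)) / c\<^sup>2"
      unfolding cl by (simp_all add: exp_add exp_minus exp_diff field_simps power2_eq_square)
    show ?thesis
    proof (cases "r \<ge> 0")
      case True
      then have u: "?u \<ge> 0" using l by simp
      have "exp (- (r / l)) \<le> 1" using True l by simp
      also have "1 \<le> c\<^sup>2" using c by simp
      finally have "0 \<le> (exp (r / l) - 1) * (1 - exp (- (r / l)) / c\<^sup>2)"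
        using c l True by (intro mult_nonneg_nonneg) auto
      then have m: "max 0 ((exp ?u / c - 1) * (1 - exp (- ?u) / c)) =
          (l * (exp (r / l) - 1) * (1 - exp (- (r / l)) / c\<^sup>2)) / l"
        unfolding eu using l by simp
      have e: "- ?u\<^sup>2 / (2 * a) = - l\<^sup>2 / (2 * a) + (- (r / a) - r\<^sup>2 / (2 * a * l\<^sup>2))"
        using a l by (simp add: field_simps power2_eq_square)
      have u': "?u = l * (1 + r / l\<^sup>2)"
        using l by (simp add: field_simps power2_eq_square)
      have "cut_density a c ?u = l * (1 + r / l\<^sup>2) / a *
          (exp (- l\<^sup>2 / (2 * a)) * exp (- (r / a) - r\<^sup>2 / (2 * a * l\<^sup>2))) *
          (sqrt (l * (exp (r / l) - 1) * (1 - exp (- (r / l)) / c\<^sup>2)) / sqrt l)"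
        unfolding cut_density_def m e unfolding exp_add real_sqrt_divide u' ..
      then show ?thesis
        unfolding laplace_integrand_def l_def[symmetric] using u True by simp
    next
      case False
      \<comment> \<open>Negative \<open>r\<close> means \<open>?u < l\<close>: either
        \<open>?u\<close> is negative and the indicator vanishes, or it lies before the branch point
        and the \<open>max 0\<close> does.\<close>
      have "indicator {0..} ?u * sqrt (max 0 ((exp ?u / c - 1) * (1 - exp (- ?u) / c))) = 0"
      proof (cases "?u \<ge> 0")
        case True
        then have "exp (- ?u) \<le> 1" by simp
        with c have "exp (- ?u) \<le> c" by linarith
        then have "(exp ?u / c - 1) * (1 - exp (- ?u) / c) \<le> 0"
          unfolding eu(1) using c l False by (intro mult_nonpos_nonneg) (auto simp: field_simps)
        then show ?thesis by simp
      qed simp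
      then have "indicator {0..} ?u * cut_density a c ?u = 0"
        unfolding cut_density_def by (metis mult.left_commute mult_zero_right)
      then show ?thesis
        using False by (simp add: laplace_integrand_def)
    qed
  qed
  have "(LBINT u:{0..}. cut_density a c u) =
      \<bar>1 / l\<bar> * (LBINT r. indicator {0..} (l + 1 / l * r) * cut_density a c (l + 1 / l * r))"
    unfolding set_lebesgue_integral_def using l
    by (subst lborel_integral_real_affine[of "1 / l" _ l]) auto
  also have "\<dots> = exp (- l\<^sup>2 / (2 * a)) / (a * sqrt l) * (LBINT r. laplace_integrand a c r)"
    unfolding pointwise using l by simp
  finally show ?thesis by (simp add: l_def)
qed

text \<open>Of the decay \<open>exp (- (r / a))\<close>, the polynomial factor and the root each
  spend \<open>exp (r / (4 * a))\<close>, so half of the rate survives. \<open>ln c \<ge> 1\<close>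
  serves the polynomial, \<open>ln c \<ge> 2 * a\<close> the root.\<close>

lemma laplace_integrand_le:
  assumes a: "a > 0" and c1: "c > 1" and c: "ln c \<ge> max 1 (2 * a)"
  shows "\<bar>laplace_integrand a c r\<bar> \<le>
    max 1 (4 * a) * (indicator {0..} r * (r powr (3 / 2 - 1) * exp (- (r / (2 * a)))))"
proof (cases "r \<ge> 0")
  case r: True
  define l where "l = ln c"
  have l: "l \<ge> 1" "l \<ge> 2 * a" using c by (auto simp: l_def)
  have poly: "1 + r / l\<^sup>2 \<le> max 1 (4 * a) * exp (r / (4 * a))"
  proof -
    have "r / l\<^sup>2 \<le> r / 1" using r l by (intro divide_left_mono one_le_power) auto
    then have "r / l\<^sup>2 \<le> r" by simp
    also have "r = (4 * a) * (r / (4 * a))" using a by simp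
    also have "\<dots> \<le> max 1 (4 * a) * (r / (4 * a))"
      using a r by (intro mult_right_mono) auto
    finally have "1 + r / l\<^sup>2 \<le> max 1 (4 * a) * 1 + max 1 (4 * a) * (r / (4 * a))"
      by simp
    also have "\<dots> = max 1 (4 * a) * (1 + r / (4 * a))"
      by (simp only: distrib_left)
    also have "\<dots> \<le> max 1 (4 * a) * exp (r / (4 * a))"
      by (intro mult_left_mono exp_ge_add_one_self) auto
    finally show ?thesis .
  qed
  have gauss: "exp (- (r / a) - r\<^sup>2 / (2 * a * l\<^sup>2)) \<le> exp (- (r / a))"
    using a by simp
  have "exp (- (r / l)) \<le> 1" using r l by simp
  also have "1 \<le> c\<^sup>2" using c1 by simp
  finally have b: "0 \<le> 1 - exp (- (r / l)) / c\<^sup>2" "1 - exp (- (r / l)) / c\<^sup>2 \<le> 1"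
    using c1 by auto
  \<comment> \<open>Multiplied by \<open>exp (r / l)\<close>, this bounds
    \<open>exp (r / l) - 1\<close> by \<open>r / l * exp (r / l)\<close>, which supplies the factor
    \<open>r\<close> under the root.\<close>
  have "1 - r / l \<le> exp (- (r / l))"
    using exp_ge_add_one_self[of "- (r / l)"] by simp
  then have "(1 - r / l) * exp (r / l) \<le> exp (- (r / l)) * exp (r / l)"
    by (intro mult_right_mono) auto
  then have "exp (r / l) - 1 \<le> r / l * exp (r / l)"
    by (simp add: algebra_simps flip: exp_add)
  then have "l * (exp (r / l) - 1) \<le> r * exp (r / l)"
    using l by (simp add: field_simps)
  also have "\<dots> \<le> r * exp (r / (2 * a))"
    using r l a by (intro mult_left_mono) (auto intro!: divide_left_mono)
  finally have "l * (exp (r / l) - 1) \<le> r * exp (r / (2 * a))" .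
  then have "l * (exp (r / l) - 1) * (1 - exp (- (r / l)) / c\<^sup>2) \<le> r * exp (r / (2 * a)) * 1"
    by (rule mult_mono) (use b r in auto)
  then have "sqrt (l * (exp (r / l) - 1) * (1 - exp (- (r / l)) / c\<^sup>2)) \<le> sqrt (r * exp (r / (2 * a)))"
    by (intro real_sqrt_le_mono) simp
  also have "exp (r / (2 * a)) = (exp (r / (4 * a)))\<^sup>2"
    by (simp flip: exp_double)
  finally have root: "sqrt (l * (exp (r / l) - 1) * (1 - exp (- (r / l)) / c\<^sup>2)) \<le> sqrt r * exp (r / (4 * a))"
    by (simp add: real_sqrt_mult)
  have "laplace_integrand a c r \<le>
      max 1 (4 * a) * exp (r / (4 * a)) * exp (- (r / a)) * (sqrt r * exp (r / (4 * a)))"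
    unfolding laplace_integrand_def l_def[symmetric] using r
    by (simp, intro mult_mono poly gauss root) (use b l in auto)
  also have "\<dots> = max 1 (4 * a) * (sqrt r * (exp (r / (4 * a)) * exp (- (r / a)) * exp (r / (4 * a))))"
    by (simp only: mult_ac)
  also have "exp (r / (4 * a)) * exp (- (r / a)) * exp (r / (4 * a)) = exp (- (r / (2 * a)))"
    using a by (simp flip: exp_add add: field_simps)
  finally have "laplace_integrand a c r \<le> max 1 (4 * a) * (sqrt r * exp (- (r / (2 * a))))" .
  moreover have "laplace_integrand a c r \<ge> 0"
    unfolding laplace_integrand_def l_def[symmetric] using r l b by simp
  ultimately show ?thesis using r by (simp add: powr_half_sqrt)
qed (simp add: laplace_integrand_def)

lemma laplace_integral_tendsto:
  assumes a: "a > 0"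
  shows "((\<lambda>c. LBINT r. laplace_integrand a c r) \<longlongrightarrow> sqrt pi / 2 * (a * sqrt a)) at_top"
proof -
  let ?g = "\<lambda>k r. indicator {0..} r * (r powr (3 / 2 - 1) * exp (- (r / k)))"
  have "((\<lambda>c. LBINT r. laplace_integrand a c r) \<longlongrightarrow> (LBINT r. ?g a r)) at_top"
  proof (rule integral_dominated_convergence_at_top)
    show "laplace_integrand a c \<in> borel_measurable lborel" for c
      unfolding laplace_integrand_def by measurable
    show "integrable lborel (\<lambda>r. max 1 (4 * a) * ?g (2 * a) r)"
      using has_bochner_integral_Gamma[of "3/2" "2 * a"] a
      by (intro integrable_mult_right) (simp add: has_bochner_integral_iff)
    have "\<forall>\<^sub>F c in at_top. ln c \<ge> max 1 (2 * a)"
      using ln_at_top by (simp only: filterlim_at_top)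
    with eventually_gt_at_top[of 1] show "\<forall>\<^sub>F c in at_top. AE r in lborel.
        norm (laplace_integrand a c r) \<le> max 1 (4 * a) * ?g (2 * a) r"
      by eventually_elim (use laplace_integrand_le[OF a] in simp)
    have "((\<lambda>c. laplace_integrand a c r) \<longlongrightarrow> ?g a r) at_top" for r
    proof -
      \<comment> \<open>For \<open>r < 0\<close> the indicator gives zero; at \<open>r = 0\<close>
        the root vanishes and so does \<open>0 powr (1 / 2)\<close>. Only \<open>r > 0\<close> needs
        an asymptotic argument.\<close>
      consider "r < 0" | "r = 0" | "r > 0" by linarith
      then show ?thesis
      proof cases
        case 3
        then have "((\<lambda>c. (1 + r / (ln c)\<^sup>2) * exp (- (r / a) - r\<^sup>2 / (2 * a * (ln c)\<^sup>2)) *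
            sqrt (ln c * (exp (r / ln c) - 1) * (1 - exp (- (r / ln c)) / c\<^sup>2)))
            \<longlongrightarrow> exp (- (r / a)) * r powr (1 / 2)) at_top"
          using a by real_asymp
        then show ?thesis
          unfolding laplace_integrand_def using 3 by (simp add: mult.commute)
      qed (simp_all add: laplace_integrand_def)
    qed
    then show "AE r in lborel. ((\<lambda>c. laplace_integrand a c r) \<longlongrightarrow> ?g a r) at_top" by simp
  qed measurable
  also have "(LBINT r. ?g a r) = Gamma (3/2) * a powr (3/2)"
    using has_bochner_integral_Gamma[of "3/2" a] a by (simp add: has_bochner_integral_iff)
  also have "Gamma (3/2 :: real) = sqrt pi / 2"
    using Gamma_plus1[of "1/2 :: real"] nonpos_Ints_nonpos[of "1/2 :: real"]
    by (auto simp: Gamma_one_half_real)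
  also have "a powr (3/2) = a * sqrt a"
    using a powr_add[of a 1 "1/2"] by (simp add: powr_half_sqrt)
  finally show ?thesis .
qed

section \<open>Collecting the constants\<close>

theorem theorem4p2:
  fixes \<phi> :: "real \<Rightarrow> real" and t :: real
  assumes nonneg: "\<And>q. \<phi> q \<ge> 0"
    and smooth: "smooth \<phi>"
    and compact_support: "compact_support \<phi>"
    and even: "\<And>q. \<phi> q = \<phi> (- q)"
    and normalized: "(LBINT q. (\<phi> q)\<^sup>2) = 1"
    and t: "t > 0"
  shows "\<exists>\<epsilon> \<in> o[at_top](\<lambda>_. 1). \<forall>\<^sub>F c in at_top.
    mu_bar \<phi> t c =
      exp (- (L' \<phi> * t / 8)) * sqrt (L'' \<phi>) / (pi * sqrt (2 * L' \<phi>))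
      * sqrt (c / ln c) * exp (- ((ln c)\<^sup>2 / (2 * L' \<phi> * t))) * (1 + \<epsilon> c)"
proof (cases "L' \<phi> = 0")
  case True
  \<comment> \<open>Both sides vanish because of \<open>x / 0 = 0\<close>.\<close>
  then show ?thesis
    by (intro bexI[of _ "\<lambda>_. 0"]) (simp_all add: mu_bar_def)
next
  case False
  define b where "b = L' \<phi>"
  define a where "a = b * t"
  have "L' \<phi> \<ge> 0" unfolding L'_def by (rule Bochner_Integration.integral_nonneg) simp
  with False have b: "b > 0" by (simp add: b_def)
  with t have a: "a > 0" by (simp add: a_def)
  let ?m = "sqrt pi / 2 * (a * sqrt a)"
  \<comment> \<open>\<open>\<epsilon>\<close> is the exact relative error of the Laplace integral,
    so for every \<open>c > 1\<close> the claimed formula becomes an identity and only constants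
    remain to be matched.\<close>
  define \<epsilon> where "\<epsilon> c = (LBINT r. laplace_integrand a c r) / ?m - 1" for c
  have m: "?m > 0" using a by simp
  have "(\<epsilon> \<longlongrightarrow> ?m / ?m - 1) at_top"
    unfolding \<epsilon>_def using a by (intro tendsto_intros laplace_integral_tendsto a) simp
  then have "(\<epsilon> \<longlongrightarrow> 0) at_top" using a by simp
  then have "\<epsilon> \<in> o[at_top](\<lambda>_. 1)" by (intro smalloI_tendsto) auto
  moreover have "\<forall>\<^sub>F c in at_top.
    mu_bar \<phi> t c =
      exp (- (L' \<phi> * t / 8)) * sqrt (L'' \<phi>) / (pi * sqrt (2 * L' \<phi>))
      * sqrt (c / ln c) * exp (- ((ln c)\<^sup>2 / (2 * L' \<phi> * t))) * (1 + \<epsilon> c)"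
    using eventually_gt_at_top[of 1]
  proof eventually_elim
    case (elim c)
    define J where "J = (LBINT r. laplace_integrand a c r)"
    have J: "J = ?m * (1 + \<epsilon> c)" using a by (simp add: \<epsilon>_def J_def)
    let ?e = "exp (pi\<^sup>2 / (2 * a) - a / 8)"
    define l where "l = ln c"
    have l: "l > 0" using elim by (simp add: l_def)
    have "mu_bar \<phi> t c = sqrt (2 * L'' \<phi>) * ?e / (pi * b * sqrt (pi * t)) * (1 / sqrt c)
        * (c * exp (- pi\<^sup>2 / (2 * a)) * (exp (- l\<^sup>2 / (2 * a)) / (a * sqrt l) * J))"
      unfolding mu_bar_def b_def[symmetric] mult.assoc[of 2 b t] a_def[symmetric]
        J_def l_def
      using elim a by (simp only: contour_shift integral_cut_density_rescale less_imp_le)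
    also have "?e = exp (pi\<^sup>2 / (2 * a)) * exp (- (a / 8))"
      by (simp flip: exp_add)
    also have "sqrt (2 * L'' \<phi>) * (exp (pi\<^sup>2 / (2 * a)) * exp (- (a / 8))) / (pi * b * sqrt (pi * t)) * (1 / sqrt c)
        * (c * exp (- pi\<^sup>2 / (2 * a)) * (exp (- l\<^sup>2 / (2 * a)) / (a * sqrt l) * J))
      = (exp (pi\<^sup>2 / (2 * a)) * exp (- pi\<^sup>2 / (2 * a))) * exp (- (a / 8)) * sqrt (L'' \<phi>) / pi
        * (c / sqrt c / sqrt l) * exp (- l\<^sup>2 / (2 * a)) * (sqrt 2 / (b * sqrt (pi * t) * a) * J)"
      by (simp add: real_sqrt_mult mult_ac)
    also have "exp (pi\<^sup>2 / (2 * a)) * exp (- pi\<^sup>2 / (2 * a)) = 1"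
      by (simp flip: exp_add)
    also have "c / sqrt c / sqrt l = sqrt (c / l)"
      using elim by (simp add: real_sqrt_divide real_div_sqrt)
    \<comment> \<open>With \<open>a = b * t\<close>, the factor \<open>a * sqrt a\<close> in
      \<open>J\<close> cancels \<open>a\<close> and \<open>sqrt t\<close>, its
      \<open>sqrt pi\<close> cancels the other one, and only \<open>b\<close> survives.\<close>
    also have "sqrt 2 / (b * sqrt (pi * t) * a) * J = (1 + \<epsilon> c) / sqrt (2 * b)"
    proof -
      have "sqrt 2 / (b * sqrt (pi * t) * a) * J = (sqrt 2 / 2) * (sqrt b / b) * (1 + \<epsilon> c)"
        unfolding J a_def real_sqrt_mult using b t by (simp add: field_simps)
      also have "\<dots> = inverse (sqrt 2) * inverse (sqrt b) * (1 + \<epsilon> c)"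
        using b by (simp only: sqrt_divide_self_eq less_imp_le zero_le_numeral)
      finally show ?thesis
        by (simp add: real_sqrt_mult field_simps)
    qed
    finally show ?case
      by (simp add: b_def a_def l_def mult_ac)
  qed
  ultimately show ?thesis by blast
qed

end
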